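(* Let $V$ be a model of ZFC, let $\mathcal{G}$ be a $V$-generic filter for $\mathbb{P}$, and work in $V[\mathcal{G}]$. The first projection $\pi_1:\omega^2\to\omega$, $\pi_1(\langle n,m\rangle)=n$, is not finite-to-one or constant on any set in $\mathcal{G}$. Thus, $\mathcal{G}$ is not a P-point.
   Context: For $p\subseteq\omega^2$, $p(n)=\{m:\langle n,m\rangle\in p\}$. $\mathcal{F}$ is the Fréchet filter on $\omega$, and $\mathcal{F}^{\otimes 2}$ is the filter of all $X\subseteq\omega^2$ such that $X(n)$ is cofinite for all but finitely many $n$. The forcing $\mathbb{P}=(\mathcal{F}^{\otimes 2})^+$ consists of the sets $p\subseteq\omega^2$ such that $p(n)$ is infinite for infinitely many $n$, ordered by inclusion. A $V$-generic filter for $\mathbb{P}$ is an ultrafilter on $\omega^2$ in the extension. An ultrafilter $\mathcal{W}$ on a countable set $S$ is a P-point if for every $f:S\to\omega$ there is $A\in\mathcal{W}$ on which $f$ is finite-to-one or constant. *)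

theory Defs
  imports Main
begin

section \<open>First-order formulas of set theory\<close>

datatype fm = Mem nat nat | Eq nat nat | Neg fm | Conj fm fm | All nat fm

primrec sat :: "'a set \<Rightarrow> ('a \<Rightarrow> 'a \<Rightarrow> bool) \<Rightarrow> (nat \<Rightarrow> 'a) \<Rightarrow> fm \<Rightarrow> bool" where
  "sat M E s (Mem i j) \<longleftrightarrow> E (s i) (s j)"
| "sat M E s (Eq i j) \<longleftrightarrow> s i = s j"
| "sat M E s (Neg \<phi>) \<longleftrightarrow> \<not> sat M E s \<phi>"
| "sat M E s (Conj \<phi> \<psi>) \<longleftrightarrow> sat M E s \<phi> \<and> sat M E s \<psi>"
| "sat M E s (All i \<phi>) \<longleftrightarrow> (\<forall>a\<in>M. sat M E (s(i := a)) \<phi>)"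


section \<open>Set theory inside a structure\<close>

text \<open>
  A structure \<open>(M, \<epsilon>)\<close> for the language of set theory; it is not required to be well-founded.
  Every definition below is the relativization to \<open>M\<close> of the usual set-theoretic one, so that
  \<open>set_model.finite_set M E x\<close>, say, reads: \<open>(M, E)\<close> satisfies ``\<open>x\<close> is finite''.
\<close>

locale set_model =
  fixes M :: "'a set" and E :: "'a \<Rightarrow> 'a \<Rightarrow> bool"  (infix "\<epsilon>" 50)
begin

definition is_empty :: "'a \<Rightarrow> bool" where
  "is_empty x \<longleftrightarrow> (\<forall>y\<in>M. \<not> y \<epsilon> x)"

definition sub :: "'a \<Rightarrow> 'a \<Rightarrow> bool" where
  "sub x y \<longleftrightarrow> (\<forall>z\<in>M. z \<epsilon> x \<longrightarrow> z \<epsilon> y)"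

text \<open>\<open>is_upair x y z\<close>: \<open>z = {x, y}\<close>.  \<open>is_pair x y z\<close>: \<open>z = \<langle>x, y\<rangle>\<close> (Kuratowski).\<close>

definition is_upair :: "'a \<Rightarrow> 'a \<Rightarrow> 'a \<Rightarrow> bool" where
  "is_upair x y z \<longleftrightarrow> (\<forall>w\<in>M. w \<epsilon> z \<longleftrightarrow> w = x \<or> w = y)"

definition is_pair :: "'a \<Rightarrow> 'a \<Rightarrow> 'a \<Rightarrow> bool" where
  "is_pair x y z \<longleftrightarrow>
     (\<exists>u\<in>M. \<exists>v\<in>M. is_upair x x u \<and> is_upair x y v \<and> is_upair u v z)"

text \<open>\<open>is_succ x y\<close>: \<open>y = x \<union> {x}\<close>.\<close>

definition is_succ :: "'a \<Rightarrow> 'a \<Rightarrow> bool" where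
  "is_succ x y \<longleftrightarrow> (\<forall>w\<in>M. w \<epsilon> y \<longleftrightarrow> w \<epsilon> x \<or> w = x)"

definition is_inductive :: "'a \<Rightarrow> bool" where
  "is_inductive x \<longleftrightarrow>
     (\<exists>e\<in>M. is_empty e \<and> e \<epsilon> x) \<and>
     (\<forall>y\<in>M. y \<epsilon> x \<longrightarrow> (\<exists>z\<in>M. is_succ y z \<and> z \<epsilon> x))"

definition is_omega :: "'a \<Rightarrow> bool" where
  "is_omega x \<longleftrightarrow> is_inductive x \<and> (\<forall>y\<in>M. is_inductive y \<longrightarrow> sub x y)"


subsection \<open>The axioms of ZFC\<close>

text \<open>
  The assignment \<open>s\<close> supplies the parameters of the schemas.  In Separation the variable 0
  stands for the element; in Replacement the variables 0 and 1 stand for argument and value.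
\<close>

definition ZFC :: bool where
  "ZFC \<longleftrightarrow>
     \<comment> \<open>Extensionality\<close>
     (\<forall>x\<in>M. \<forall>y\<in>M. (\<forall>z\<in>M. z \<epsilon> x \<longleftrightarrow> z \<epsilon> y) \<longrightarrow> x = y) \<and>
     \<comment> \<open>Foundation\<close>
     (\<forall>x\<in>M. \<not> is_empty x \<longrightarrow> (\<exists>y\<in>M. y \<epsilon> x \<and> (\<forall>z\<in>M. \<not> (z \<epsilon> x \<and> z \<epsilon> y)))) \<and>
     \<comment> \<open>Pairing\<close>
     (\<forall>x\<in>M. \<forall>y\<in>M. \<exists>z\<in>M. is_upair x y z) \<and>
     \<comment> \<open>Union\<close>
     (\<forall>x\<in>M. \<exists>u\<in>M. \<forall>z\<in>M. z \<epsilon> u \<longleftrightarrow> (\<exists>y\<in>M. y \<epsilon> x \<and> z \<epsilon> y)) \<and>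
     \<comment> \<open>Power set\<close>
     (\<forall>x\<in>M. \<exists>p\<in>M. \<forall>z\<in>M. z \<epsilon> p \<longleftrightarrow> sub z x) \<and>
     \<comment> \<open>Infinity\<close>
     (\<exists>x\<in>M. is_inductive x) \<and>
     \<comment> \<open>Separation\<close>
     (\<forall>\<phi> s. range s \<subseteq> M \<longrightarrow>
        (\<forall>x\<in>M. \<exists>y\<in>M. \<forall>z\<in>M. z \<epsilon> y \<longleftrightarrow> z \<epsilon> x \<and> sat M E (s(0 := z)) \<phi>)) \<and>
     \<comment> \<open>Replacement\<close>
     (\<forall>\<phi> s. range s \<subseteq> M \<longrightarrow>
        (\<forall>x\<in>M. (\<forall>a\<in>M. a \<epsilon> x \<longrightarrow> (\<exists>!b. b \<in> M \<and> sat M E (s(0 := a, 1 := b)) \<phi>)) \<longrightarrow>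
           (\<exists>y\<in>M. \<forall>b\<in>M. b \<epsilon> y \<longleftrightarrow> (\<exists>a\<in>M. a \<epsilon> x \<and> sat M E (s(0 := a, 1 := b)) \<phi>)))) \<and>
     \<comment> \<open>Choice\<close>
     (\<forall>x\<in>M.
        (\<forall>y\<in>M. y \<epsilon> x \<longrightarrow> \<not> is_empty y) \<and>
        (\<forall>y\<in>M. \<forall>z\<in>M. y \<epsilon> x \<and> z \<epsilon> x \<and> y \<noteq> z \<longrightarrow> (\<forall>w\<in>M. \<not> (w \<epsilon> y \<and> w \<epsilon> z))) \<longrightarrow>
        (\<exists>c\<in>M. \<forall>y\<in>M. y \<epsilon> x \<longrightarrow> (\<exists>!w. w \<in> M \<and> w \<epsilon> y \<and> w \<epsilon> c)))"


subsection \<open>Functions, finiteness, and \<open>\<omega>\<^sup>2\<close>\<close>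

definition is_prod :: "'a \<Rightarrow> 'a \<Rightarrow> 'a \<Rightarrow> bool" where
  "is_prod x y z \<longleftrightarrow>
     (\<forall>w\<in>M. w \<epsilon> z \<longleftrightarrow> (\<exists>a\<in>M. \<exists>b\<in>M. a \<epsilon> x \<and> b \<epsilon> y \<and> is_pair a b w))"

text \<open>\<open>rel r a b\<close>: \<open>\<langle>a, b\<rangle> \<in> r\<close>; for a function \<open>r\<close> this says \<open>r(a) = b\<close>.\<close>

definition rel :: "'a \<Rightarrow> 'a \<Rightarrow> 'a \<Rightarrow> bool" where
  "rel r a b \<longleftrightarrow> (\<exists>w\<in>M. is_pair a b w \<and> w \<epsilon> r)"

definition is_fun :: "'a \<Rightarrow> 'a \<Rightarrow> 'a \<Rightarrow> bool" where
  "is_fun f x y \<longleftrightarrow>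
     (\<forall>w\<in>M. w \<epsilon> f \<longrightarrow> (\<exists>a\<in>M. \<exists>b\<in>M. a \<epsilon> x \<and> b \<epsilon> y \<and> is_pair a b w)) \<and>
     (\<forall>a\<in>M. a \<epsilon> x \<longrightarrow> (\<exists>!b. b \<in> M \<and> rel f a b))"

definition is_bij :: "'a \<Rightarrow> 'a \<Rightarrow> 'a \<Rightarrow> bool" where
  "is_bij f x y \<longleftrightarrow> is_fun f x y \<and> (\<forall>b\<in>M. b \<epsilon> y \<longrightarrow> (\<exists>!a. a \<in> M \<and> rel f a b))"

definition finite_set :: "'a \<Rightarrow> bool" where
  "finite_set x \<longleftrightarrow>
     (\<exists>om\<in>M. \<exists>n\<in>M. \<exists>f\<in>M. is_omega om \<and> n \<epsilon> om \<and> is_bij f n x)"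

definition is_omega_sq :: "'a \<Rightarrow> bool" where
  "is_omega_sq S \<longleftrightarrow> (\<exists>om\<in>M. is_omega om \<and> is_prod om om S)"

definition is_proj1 :: "'a \<Rightarrow> 'a \<Rightarrow> bool" where
  "is_proj1 S f \<longleftrightarrow>
     (\<exists>om\<in>M. is_omega om \<and> is_fun f S om) \<and>
     (\<forall>n\<in>M. \<forall>m\<in>M. \<forall>w\<in>M. is_pair n m w \<and> w \<epsilon> S \<longrightarrow> rel f w n)"


subsection \<open>The forcing, and generic filters over the structure\<close>

text \<open>\<open>is_section p n x\<close>: \<open>x = p(n) = {m. \<langle>n, m\<rangle> \<in> p}\<close>.\<close>

definition is_section :: "'a \<Rightarrow> 'a \<Rightarrow> 'a \<Rightarrow> bool" where
  "is_section p n x \<longleftrightarrow> (\<forall>m\<in>M. m \<epsilon> x \<longleftrightarrow> rel p n m)"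

text \<open>\<open>p \<subseteq> \<omega>\<^sup>2\<close>, and the set \<open>I\<close> of all \<open>n\<close> with \<open>p(n)\<close> infinite is itself infinite.\<close>

definition is_condition :: "'a \<Rightarrow> bool" where
  "is_condition p \<longleftrightarrow>
     (\<exists>S\<in>M. is_omega_sq S \<and> sub p S) \<and>
     (\<exists>om\<in>M. \<exists>I\<in>M. is_omega om \<and>
        (\<forall>n\<in>M. n \<epsilon> I \<longleftrightarrow> n \<epsilon> om \<and> (\<exists>x\<in>M. is_section p n x \<and> \<not> finite_set x)) \<and>
        \<not> finite_set I)"

definition is_forcing :: "'a \<Rightarrow> bool" where
  "is_forcing P \<longleftrightarrow> (\<forall>p\<in>M. p \<epsilon> P \<longleftrightarrow> is_condition p)"

definition dense_in :: "'a \<Rightarrow> 'a \<Rightarrow> bool" where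
  "dense_in P D \<longleftrightarrow> sub D P \<and> (\<forall>p\<in>M. p \<epsilon> P \<longrightarrow> (\<exists>q\<in>M. q \<epsilon> D \<and> sub q p))"

text \<open>
  \<open>P\<close> is ordered by inclusion.  The filter \<open>F\<close> need not be an element of the structure, so it
  is an external set of elements; the dense sets range over the elements of the structure.
\<close>

definition generic_filter :: "'a \<Rightarrow> 'a set \<Rightarrow> bool" where
  "generic_filter P F \<longleftrightarrow>
     F \<noteq> {} \<and> F \<subseteq> {p \<in> M. p \<epsilon> P} \<and>
     (\<forall>p\<in>F. \<forall>q\<in>M. q \<epsilon> P \<and> sub p q \<longrightarrow> q \<in> F) \<and>
     (\<forall>p\<in>F. \<forall>q\<in>F. \<exists>r\<in>F. sub r p \<and> sub r q) \<and>
     (\<forall>D\<in>M. dense_in P D \<longrightarrow> (\<exists>p\<in>F. p \<epsilon> D))"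


subsection \<open>Evaluation of names\<close>

definition transitive_set :: "'a \<Rightarrow> bool" where
  "transitive_set x \<longleftrightarrow> (\<forall>y\<in>M. y \<epsilon> x \<longrightarrow> sub y x)"

text \<open>
  \<open>is_val G \<tau> x\<close>: \<open>x = val(\<tau>, G)\<close>, where \<open>val(\<sigma>, G) = {val(\<rho>, G) | \<rho>. \<exists>p\<in>G. \<langle>\<rho>, p\<rangle> \<in> \<sigma>}\<close>.
  The recursion is witnessed by a function \<open>f\<close> on a transitive set \<open>T\<close> containing \<open>\<tau>\<close>.
  Every set counts as a name; members that are not pairs with second component in \<open>G\<close> are ignored.
\<close>

definition is_val :: "'a \<Rightarrow> 'a \<Rightarrow> 'a \<Rightarrow> bool" where
  "is_val G \<tau> x \<longleftrightarrow>
     (\<exists>T\<in>M. \<exists>R\<in>M. \<exists>f\<in>M. transitive_set T \<and> \<tau> \<epsilon> T \<and> is_fun f T R \<and>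
        (\<forall>\<sigma>\<in>M. \<forall>y\<in>M. \<sigma> \<epsilon> T \<and> rel f \<sigma> y \<longrightarrow>
           (\<forall>z\<in>M. z \<epsilon> y \<longleftrightarrow> (\<exists>\<rho>\<in>M. \<exists>p\<in>M. p \<epsilon> G \<and> rel \<sigma> \<rho> p \<and> rel f \<rho> z))) \<and>
        rel f \<tau> x)"


subsection \<open>Ultrafilters and P-points\<close>

definition ultrafilter_on :: "'a \<Rightarrow> 'a \<Rightarrow> bool" where
  "ultrafilter_on S U \<longleftrightarrow>
     (\<forall>A\<in>M. A \<epsilon> U \<longrightarrow> sub A S) \<and>
     S \<epsilon> U \<and>
     (\<forall>A\<in>M. A \<epsilon> U \<longrightarrow> \<not> is_empty A) \<and>
     (\<forall>A\<in>M. \<forall>B\<in>M. A \<epsilon> U \<and> sub A B \<and> sub B S \<longrightarrow> B \<epsilon> U) \<and>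
     (\<forall>A\<in>M. \<forall>B\<in>M. \<forall>C\<in>M.
        A \<epsilon> U \<and> B \<epsilon> U \<and> (\<forall>x\<in>M. x \<epsilon> C \<longleftrightarrow> x \<epsilon> A \<and> x \<epsilon> B) \<longrightarrow> C \<epsilon> U) \<and>
     (\<forall>A\<in>M. \<forall>B\<in>M.
        sub A S \<and> (\<forall>x\<in>M. x \<epsilon> B \<longleftrightarrow> x \<epsilon> S \<and> \<not> x \<epsilon> A) \<longrightarrow> A \<epsilon> U \<or> B \<epsilon> U)"

definition finite_to_one_on :: "'a \<Rightarrow> 'a \<Rightarrow> bool" where
  "finite_to_one_on f A \<longleftrightarrow>
     (\<forall>k\<in>M. \<forall>B\<in>M. (\<forall>x\<in>M. x \<epsilon> B \<longleftrightarrow> x \<epsilon> A \<and> rel f x k) \<longrightarrow> finite_set B)"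

definition constant_on :: "'a \<Rightarrow> 'a \<Rightarrow> bool" where
  "constant_on f A \<longleftrightarrow> (\<exists>k\<in>M. \<forall>x\<in>M. x \<epsilon> A \<longrightarrow> rel f x k)"

text \<open>Countability of \<open>S\<close> is left to the uses of this notion.\<close>

definition P_point :: "'a \<Rightarrow> 'a \<Rightarrow> bool" where
  "P_point S U \<longleftrightarrow> ultrafilter_on S U \<and>
     (\<forall>om\<in>M. \<forall>f\<in>M. is_omega om \<and> is_fun f S om \<longrightarrow>
        (\<exists>A\<in>M. A \<epsilon> U \<and> (finite_to_one_on f A \<or> constant_on f A)))"

end


section \<open>Generic extensions\<close>

text \<open>
  \<open>(W, E)\<close> is \<open>V[G]\<close>: a model of ZFC that contains \<open>V\<close> as a transitive subclass and \<open>G\<close> as an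
  element, and that consists of the values under \<open>G\<close> of the names in \<open>V\<close>.  For a \<open>V\<close>-generic
  \<open>G\<close> this determines \<open>(W, E)\<close> up to isomorphism over \<open>V\<close>, also when \<open>V\<close> is not well-founded;
  that \<open>V[G]\<close> has these properties is the generic model theorem.
\<close>

definition generic_extension :: "'a set \<Rightarrow> ('a \<Rightarrow> 'a \<Rightarrow> bool) \<Rightarrow> 'a \<Rightarrow> 'a set \<Rightarrow> bool" where
  "generic_extension V E G W \<longleftrightarrow>
     V \<subseteq> W \<and>
     (\<forall>x\<in>V. \<forall>y\<in>W. E y x \<longrightarrow> y \<in> V) \<and>
     set_model.ZFC W E \<and>
     G \<in> W \<and>
     (\<forall>x\<in>W. \<exists>\<tau>\<in>V. set_model.is_val W E G \<tau> x)"

end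

theory Submission
  imports Defs
begin

text \<open>
  Genericity plays no role: every member of \<open>G\<close> is a condition \<open>A\<close> of \<open>V\<close>, and no condition has a
  restriction of \<open>\<pi>\<^sub>1\<close> that is finite-to-one or constant.  It is not constant because two sections
  of \<open>A\<close> are nonempty.  If it were finite-to-one in \<open>W\<close>, then \<open>{n} \<times> A(n)\<close> would be finite in \<open>W\<close>
  for an \<open>n\<close> with \<open>A(n)\<close> infinite in \<open>V\<close>; what has to be shown is that finiteness of a set of \<open>V\<close>
  reflects from \<open>W\<close> to \<open>V\<close>, without assuming well-foundedness.
\<close>

section \<open>Definability of the notions used in Separation\<close>

context set_model
begin

text \<open>A semantic stand-in for formulas: closure lemmas replace explicit syntax. Only
  assignments into \<open>M\<close> matter, since the axiom schemas take no others.\<close>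

definition definable :: "((nat \<Rightarrow> 'a) \<Rightarrow> bool) \<Rightarrow> bool" where
  "definable Q \<longleftrightarrow> (\<exists>\<phi>. \<forall>s. range s \<subseteq> M \<longrightarrow> (sat M E s \<phi> \<longleftrightarrow> Q s))"

lemma definable_Mem: "definable (\<lambda>s. s i \<epsilon> s j)"
  unfolding definable_def by (rule exI[of _ "Mem i j"]) simp

lemma definable_Eq: "definable (\<lambda>s. s i = s j)"
  unfolding definable_def by (rule exI[of _ "Eq i j"]) simp

lemma definable_Neg: "definable Q \<Longrightarrow> definable (\<lambda>s. \<not> Q s)"
  unfolding definable_def by (metis sat.simps(3))

lemma definable_Conj: "definable Q \<Longrightarrow> definable R \<Longrightarrow> definable (\<lambda>s. Q s \<and> R s)"
  unfolding definable_def by (metis sat.simps(4))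

lemma definable_Disj: "definable Q \<Longrightarrow> definable R \<Longrightarrow> definable (\<lambda>s. Q s \<or> R s)"
  using definable_Neg[OF definable_Conj[OF definable_Neg definable_Neg]] by simp

lemma definable_Imp: "definable Q \<Longrightarrow> definable R \<Longrightarrow> definable (\<lambda>s. Q s \<longrightarrow> R s)"
  unfolding imp_conv_disj by (intro definable_Disj definable_Neg)

lemma definable_Iff: "definable Q \<Longrightarrow> definable R \<Longrightarrow> definable (\<lambda>s. Q s \<longleftrightarrow> R s)"
  unfolding iff_conv_conj_imp by (intro definable_Conj definable_Imp)

text \<open>Variable \<open>k\<close> carries the bound element, and \<open>fresh\<close> says that
  overwriting \<open>s k\<close> does not disturb the free variables of \<open>R\<close>. Taking
  \<open>k\<close> beyond the sum of the free indices makes this a matter of simplification.\<close>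

lemma definable_All:
  assumes "definable (\<lambda>s. R s (s k))" and fresh: "\<And>s a. R (s(k := a)) a \<longleftrightarrow> R s a"
  shows "definable (\<lambda>s. \<forall>a\<in>M. R s a)"
proof -
  obtain \<phi> where \<phi>: "range s \<subseteq> M \<Longrightarrow> sat M E s \<phi> \<longleftrightarrow> R s (s k)" for s
    using assms(1) unfolding definable_def by blast
  have "sat M E s (All k \<phi>) \<longleftrightarrow> (\<forall>a\<in>M. R s a)" if "range s \<subseteq> M" for s
  proof -
    have "sat M E (s(k := a)) \<phi> \<longleftrightarrow> R s a" if "a \<in> M" for a
      using \<phi>[of "s(k := a)"] fresh \<open>range s \<subseteq> M\<close> that by (auto simp: image_subset_iff)
    then show ?thesis by simp
  qed
  then show ?thesis unfolding definable_def by blast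
qed

lemma definable_Ex:
  assumes "definable (\<lambda>s. R s (s k))" and "\<And>s a. R (s(k := a)) a \<longleftrightarrow> R s a"
  shows "definable (\<lambda>s. \<exists>a\<in>M. R s a)"
proof -
  have "definable (\<lambda>s. \<not> (\<forall>a\<in>M. \<not> R s a))"
    by (rule definable_Neg, rule definable_All[where k = k]) (rule definable_Neg, simp_all only: assms)
  then show ?thesis by simp
qed

text \<open>Turns unique existence into nested bounded quantifiers, the shape that
  \<open>definable_Ex\<close> and \<open>definable_All\<close> accept.\<close>

lemma Ex1_iff: "(\<exists>!b. b \<in> M \<and> Q b) \<longleftrightarrow> (\<exists>b\<in>M. \<forall>c\<in>M. Q c \<longleftrightarrow> c = b)"
  by auto

lemmas definable_intros =
  definable_Mem definable_Eq definable_Neg definable_Conj definable_Disj definable_Imp definable_Iff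

lemma definable_is_empty: "definable (\<lambda>s. is_empty (s i))"
  unfolding is_empty_def
  by (rule definable_All[where k = "Suc i"]) (intro definable_intros, simp)

lemma definable_sub: "definable (\<lambda>s. sub (s i) (s j))"
  unfolding sub_def
  by (rule definable_All[where k = "Suc (i + j)"]) (intro definable_intros, simp)

lemma definable_is_upair: "definable (\<lambda>s. is_upair (s i) (s j) (s k))"
  unfolding is_upair_def
  by (rule definable_All[where k = "Suc (i + j + k)"]) (intro definable_intros, simp)

lemma definable_is_succ: "definable (\<lambda>s. is_succ (s i) (s j))"
  unfolding is_succ_def
  by (rule definable_All[where k = "Suc (i + j)"]) (intro definable_intros, simp)

lemma definable_is_pair: "definable (\<lambda>s. is_pair (s i) (s j) (s k))"
  unfolding is_pair_def
  apply (rule definable_Ex[where k = "Suc (i + j + k)"])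
   apply (rule definable_Ex[where k = "Suc (Suc (i + j + k))"])
    apply (intro definable_intros definable_is_upair)
  by simp_all

lemma definable_rel: "definable (\<lambda>s. rel (s i) (s j) (s k))"
  unfolding rel_def
  by (rule definable_Ex[where k = "Suc (i + j + k)"])
     (intro definable_intros definable_is_pair, simp)

lemma definable_is_inductive: "definable (\<lambda>s. is_inductive (s i))"
  unfolding is_inductive_def
  apply (rule definable_Conj)
   apply (rule definable_Ex[where k = "Suc i"])
    apply (intro definable_intros definable_is_empty)
   apply simp
  apply (rule definable_All[where k = "Suc i"])
   apply (rule definable_Imp, rule definable_Mem)
   apply (rule definable_Ex[where k = "Suc (Suc i)"])
    apply (intro definable_intros definable_is_succ)
  by simp_all

lemma definable_is_omega: "definable (\<lambda>s. is_omega (s i))"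
  unfolding is_omega_def
  apply (rule definable_Conj, rule definable_is_inductive)
  apply (rule definable_All[where k = "Suc i"])
   apply (intro definable_intros definable_is_inductive definable_sub)
  by simp

lemma definable_is_fun: "definable (\<lambda>s. is_fun (s i) (s j) (s k))"
  unfolding is_fun_def Ex1_iff
  apply (rule definable_Conj)
   apply (rule definable_All[where k = "Suc (i + j + k)"])
    apply (rule definable_Imp, rule definable_Mem)
    apply (rule definable_Ex[where k = "Suc (Suc (i + j + k))"])
     apply (rule definable_Ex[where k = "Suc (Suc (Suc (i + j + k)))"])
      apply (intro definable_intros definable_is_pair)
     apply simp_all
  apply (rule definable_All[where k = "Suc (i + j + k)"])
   apply (rule definable_Imp, rule definable_Mem)
   apply (rule definable_Ex[where k = "Suc (Suc (i + j + k))"])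
    apply (rule definable_All[where k = "Suc (Suc (Suc (i + j + k)))"])
     apply (intro definable_intros definable_rel)
  by simp_all

lemma definable_is_bij: "definable (\<lambda>s. is_bij (s i) (s j) (s k))"
  unfolding is_bij_def Ex1_iff
  apply (rule definable_Conj, rule definable_is_fun)
  apply (rule definable_All[where k = "Suc (i + j + k)"])
   apply (rule definable_Imp, rule definable_Mem)
   apply (rule definable_Ex[where k = "Suc (Suc (i + j + k))"])
    apply (rule definable_All[where k = "Suc (Suc (Suc (i + j + k)))"])
     apply (intro definable_intros definable_rel)
  by simp_all

lemma definable_finite_set: "definable (\<lambda>s. finite_set (s i))"
  unfolding finite_set_def
  apply (rule definable_Ex[where k = "Suc i"])
   apply (rule definable_Ex[where k = "Suc (Suc i)"])
    apply (rule definable_Ex[where k = "Suc (Suc (Suc i))"])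
     apply (intro definable_intros definable_is_omega definable_is_bij)
  by simp_all

lemma definable_is_section: "definable (\<lambda>s. is_section (s i) (s j) (s k))"
  unfolding is_section_def
  by (rule definable_All[where k = "Suc (i + j + k)"])
     (intro definable_intros definable_rel, simp)

text \<open>The step of finite induction, \<open>x\<close> \<union> {\<open>b\<close>}; the case
  \<open>b = x\<close> is \<open>is_succ\<close>.\<close>

definition is_adjoin :: "'a \<Rightarrow> 'a \<Rightarrow> 'a \<Rightarrow> bool" where
  "is_adjoin b x y \<longleftrightarrow> (\<forall>z\<in>M. z \<epsilon> y \<longleftrightarrow> z \<epsilon> x \<or> z = b)"

end

section \<open>The axioms of ZFC in usable form\<close>

locale zfc_model = set_model +
  assumes ZFC: ZFC
begin

lemma ZFC_ext: "\<forall>x\<in>M. \<forall>y\<in>M. (\<forall>z\<in>M. z \<epsilon> x \<longleftrightarrow> z \<epsilon> y) \<longrightarrow> x = y"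
  using ZFC unfolding ZFC_def by (elim conjE)

lemma ext: "x \<in> M \<Longrightarrow> y \<in> M \<Longrightarrow> (\<And>z. z \<in> M \<Longrightarrow> z \<epsilon> x \<longleftrightarrow> z \<epsilon> y) \<Longrightarrow> x = y"
  using ZFC_ext by blast

lemma ZFC_foundation:
  "\<forall>x\<in>M. \<not> is_empty x \<longrightarrow> (\<exists>y\<in>M. y \<epsilon> x \<and> (\<forall>z\<in>M. \<not> (z \<epsilon> x \<and> z \<epsilon> y)))"
  using ZFC unfolding ZFC_def by (elim conjE)

lemma foundation:
  assumes "x \<in> M" "a \<in> M" "a \<epsilon> x"
  obtains y where "y \<in> M" "y \<epsilon> x" "\<And>z. z \<in> M \<Longrightarrow> z \<epsilon> x \<Longrightarrow> \<not> z \<epsilon> y"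
  using ZFC_foundation assms unfolding is_empty_def by blast

lemma pairing [rule_format]: "\<forall>x\<in>M. \<forall>y\<in>M. \<exists>z\<in>M. is_upair x y z"
  using ZFC unfolding ZFC_def by (elim conjE)

lemma union [rule_format]: "\<forall>x\<in>M. \<exists>u\<in>M. \<forall>z\<in>M. z \<epsilon> u \<longleftrightarrow> (\<exists>y\<in>M. y \<epsilon> x \<and> z \<epsilon> y)"
  using ZFC unfolding ZFC_def by (elim conjE)

lemma power [rule_format]: "\<forall>x\<in>M. \<exists>p\<in>M. \<forall>z\<in>M. z \<epsilon> p \<longleftrightarrow> sub z x"
  using ZFC unfolding ZFC_def by (elim conjE)

lemma infinity: "\<exists>x\<in>M. is_inductive x"
  using ZFC unfolding ZFC_def by (elim conjE)

text \<open>Variable 0 is the element and 1, 2, 3 are parameters. Where fewer parameters are wanted,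
  an element is repeated.\<close>

lemma separation:
  assumes "definable (\<lambda>s. Q (s 0) (s 1) (s 2) (s 3))"
    and x: "x \<in> M" and abc: "a \<in> M" "b \<in> M" "c \<in> M"
  shows "\<exists>y\<in>M. \<forall>z\<in>M. z \<epsilon> y \<longleftrightarrow> z \<epsilon> x \<and> Q z a b c"
proof -
  \<comment> \<open>The default value \<open>a\<close> keeps the range of \<open>s\<close> inside
    \<open>M\<close> and also supplies variable 1.\<close>
  define s where "s = (\<lambda>_::nat. a)(2 := b, 3 := c)"
  obtain \<phi> where \<phi>: "range t \<subseteq> M \<Longrightarrow> sat M E t \<phi> \<longleftrightarrow> Q (t 0) (t 1) (t 2) (t 3)" for t
    using assms(1) unfolding definable_def by blast
  have s: "range s \<subseteq> M" using abc by (auto simp: s_def)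
  have "\<forall>\<phi> s. range s \<subseteq> M \<longrightarrow>
        (\<forall>x\<in>M. \<exists>y\<in>M. \<forall>z\<in>M. z \<epsilon> y \<longleftrightarrow> z \<epsilon> x \<and> sat M E (s(0 := z)) \<phi>)"
    using ZFC unfolding ZFC_def by (elim conjE)
  from this[rule_format, OF s x, of \<phi>]
  obtain y where y: "y \<in> M" "\<forall>z\<in>M. z \<epsilon> y \<longleftrightarrow> z \<epsilon> x \<and> sat M E (s(0 := z)) \<phi>"
    by blast
  have "sat M E (s(0 := z)) \<phi> \<longleftrightarrow> Q z a b c" if "z \<in> M" for z
    using \<phi>[of "s(0 := z)"] that abc by (auto simp: s_def)
  with y show ?thesis by auto
qed

section \<open>Pairs, functions and well-foundedness of a single set\<close>

lemma adjoin_ex: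
  assumes "b \<in> M" "x \<in> M"
  shows "\<exists>y\<in>M. is_adjoin b x y"
proof -
  obtain u where u: "u \<in> M" "is_upair b b u" using pairing assms by blast
  obtain v where v: "v \<in> M" "is_upair x u v" using pairing assms u by blast
  obtain y where "y \<in> M" "\<forall>z\<in>M. z \<epsilon> y \<longleftrightarrow> (\<exists>t\<in>M. t \<epsilon> v \<and> z \<epsilon> t)" using union v by blast
  then show ?thesis using u v assms unfolding is_upair_def is_adjoin_def by (intro bexI[of _ y]) auto
qed

lemma pair_ex:
  assumes "a \<in> M" "b \<in> M"
  shows "\<exists>w\<in>M. is_pair a b w"
  using pairing assms unfolding is_pair_def by metis

lemma upair_unique: "is_upair a b u \<Longrightarrow> is_upair a b v \<Longrightarrow> u \<in> M \<Longrightarrow> v \<in> M \<Longrightarrow> u = v"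
  by (rule ext) (auto simp: is_upair_def)

lemma pair_unique: "is_pair a b u \<Longrightarrow> is_pair a b v \<Longrightarrow> u \<in> M \<Longrightarrow> v \<in> M \<Longrightarrow> u = v"
  unfolding is_pair_def using upair_unique by metis

lemma upair_inject:
  assumes "is_upair a b u" "is_upair c d u" "a \<in> M" "b \<in> M" "c \<in> M" "d \<in> M"
  shows "a = c \<and> b = d \<or> a = d \<and> b = c"
  using assms unfolding is_upair_def by metis

lemma pair_inject:
  assumes "is_pair a b w" "is_pair c d w" "a \<in> M" "b \<in> M" "c \<in> M" "d \<in> M"
  shows "a = c \<and> b = d"
proof -
  obtain u v where uv: "u \<in> M" "v \<in> M" "is_upair a a u" "is_upair a b v" "is_upair u v w"
    using assms unfolding is_pair_def by blast
  obtain u' v' where uv': "u' \<in> M" "v' \<in> M" "is_upair c c u'" "is_upair c d v'" "is_upair u' v' w"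
    using assms unfolding is_pair_def by blast
  \<comment> \<open>With \<open>u\<close> = {\<open>a\<close>}, \<open>v\<close> =
    {\<open>a\<close>, \<open>b\<close>}, \<open>u'\<close> = {\<open>c\<close>} and
    \<open>v'\<close> = {\<open>c\<close>, \<open>d\<close>}, the crossed alternative makes all four
    elements equal.\<close>
  have "u = u' \<and> v = v' \<or> u = v' \<and> v = u'" using upair_inject uv uv' by blast
  then show ?thesis using upair_inject uv uv' assms by metis
qed

lemma rel_pair:
  assumes "is_pair a b w" "w \<in> M"
  shows "rel r a b \<longleftrightarrow> w \<epsilon> r"
  using assms pair_unique unfolding rel_def by blast

lemma rel_fun_mem:
  assumes "is_fun f x y" "rel f a b" "a \<in> M" "b \<in> M"
  shows "a \<epsilon> x \<and> b \<epsilon> y"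
  using assms pair_inject unfolding is_fun_def rel_def by metis

lemma rel_fun_unique:
  assumes "is_fun f x y" "rel f a b" "rel f a c" "a \<in> M" "b \<in> M" "c \<in> M"
  shows "b = c"
  using assms rel_fun_mem[OF assms(1,2,4,5)] unfolding is_fun_def by blast

text \<open>Foundation applied to {\<open>x\<close>}: its only member is \<open>x\<close>, which
  must therefore be disjoint from {\<open>x\<close>}.\<close>

lemma mem_irrefl: assumes "x \<in> M" shows "\<not> x \<epsilon> x"
proof -
  obtain u where u: "u \<in> M" "is_upair x x u" using pairing assms by blast
  then have "x \<epsilon> u" using assms unfolding is_upair_def by blast
  then obtain y where "y \<in> M" "y \<epsilon> u" "\<And>z. z \<in> M \<Longrightarrow> z \<epsilon> u \<Longrightarrow> \<not> z \<epsilon> y"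
    using foundation u assms by metis
  moreover from this have "y = x" using u unfolding is_upair_def by blast
  ultimately show ?thesis using assms \<open>x \<epsilon> u\<close> by blast
qed

section \<open>The set \<omega> and induction inside the structure\<close>

text \<open>The intersection of all inductive sets, cut out of one of them by Separation.\<close>

lemma omega_ex: "\<exists>om\<in>M. is_omega om"
proof -
  obtain x where x: "x \<in> M" "is_inductive x" using infinity by blast
  have "definable (\<lambda>s. \<forall>y\<in>M. is_inductive y \<longrightarrow> s 0 \<epsilon> y)"
    by (rule definable_All[where k = 1])
       (intro definable_intros definable_is_inductive, simp)
  from separation[OF this x(1) x(1) x(1) x(1)] obtain om where om: "om \<in> M"
    "\<forall>z\<in>M. z \<epsilon> om \<longleftrightarrow> z \<epsilon> x \<and> (\<forall>y\<in>M. is_inductive y \<longrightarrow> z \<epsilon> y)" by blast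
  then have om': "z \<epsilon> om \<longleftrightarrow> (\<forall>y\<in>M. is_inductive y \<longrightarrow> z \<epsilon> y)" if "z \<in> M" for z
    using x that by blast
  have sub: "sub om y" if "y \<in> M" "is_inductive y" for y
    using that om' unfolding sub_def by blast
  obtain e where e: "e \<in> M" "is_empty e" using x unfolding is_inductive_def by blast
  have "e \<epsilon> y" if "y \<in> M" "is_inductive y" for y
  proof -
    \<comment> \<open>Each inductive set comes with its own empty set; Extensionality identifies it
      with \<open>e\<close>. Successors are treated the same way below.\<close>
    obtain e' where "e' \<in> M" "is_empty e'" "e' \<epsilon> y" using \<open>is_inductive y\<close> unfolding is_inductive_def by blast
    moreover have "e = e'" using e calculation by (intro ext) (auto simp: is_empty_def)
    ultimately show ?thesis by simp
  qed
  moreover have "\<exists>z\<in>M. is_succ y z \<and> z \<epsilon> om" if y: "y \<in> M" "y \<epsilon> om" for y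
  proof -
    obtain z where z: "z \<in> M" "is_succ y z" using adjoin_ex[of y y] y unfolding is_adjoin_def is_succ_def by blast
    have "z \<epsilon> t" if t: "t \<in> M" "is_inductive t" for t
    proof -
      have "y \<epsilon> t" using om' y t by blast
      then obtain z' where z': "z' \<in> M" "is_succ y z'" "z' \<epsilon> t" using t y unfolding is_inductive_def by blast
      moreover have "z = z'" using z z' by (intro ext) (auto simp: is_succ_def)
      ultimately show ?thesis by simp
    qed
    then show ?thesis using z om' by blast
  qed
  ultimately have "is_inductive om" using e om' unfolding is_inductive_def by blast
  then show ?thesis using om sub unfolding is_omega_def by blast
qed

text \<open>Separation makes \<open>Q\<close> a subset of \<omega> that is inductive, so minimality
  of \<omega> applies. Definability of \<open>Q\<close> is essential because the structure may have
  nonstandard natural numbers.\<close>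

lemma omega_induct:
  assumes om: "om \<in> M" "is_omega om"
    and Q: "definable (\<lambda>s. Q (s 0) (s 1) (s 2) (s 3))" "a \<in> M" "b \<in> M" "c \<in> M"
    and zero: "\<And>n. n \<in> M \<Longrightarrow> is_empty n \<Longrightarrow> Q n a b c"
    and succ: "\<And>n n'. n \<in> M \<Longrightarrow> n \<epsilon> om \<Longrightarrow> Q n a b c \<Longrightarrow> n' \<in> M \<Longrightarrow> is_succ n n' \<Longrightarrow> Q n' a b c"
    and n: "n \<in> M" "n \<epsilon> om"
  shows "Q n a b c"
proof -
  obtain y where y: "y \<in> M" "\<forall>z\<in>M. z \<epsilon> y \<longleftrightarrow> z \<epsilon> om \<and> Q z a b c"
    using separation[OF Q(1) om(1) Q(2-4)] by blast
  have "is_inductive om" using om unfolding is_omega_def by blast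
  then have "is_inductive y" using y zero succ unfolding is_inductive_def by meson
  then show ?thesis using om y n unfolding is_omega_def sub_def by blast
qed

text \<open>Supplies the predecessor for the least-counterexample argument in
  \<open>omega_subset\<close>.\<close>

lemma omega_cases:
  assumes "om \<in> M" "is_omega om" "n \<in> M" "n \<epsilon> om"
  shows "is_empty n \<or> (\<exists>m\<in>M. m \<epsilon> om \<and> is_succ m n)"
proof -
  have "definable (\<lambda>s. is_empty (s 0) \<or> (\<exists>m\<in>M. m \<epsilon> s 1 \<and> is_succ m (s 0)))"
    apply (rule definable_Disj, rule definable_is_empty)
    apply (rule definable_Ex[where k = 2])
     apply (intro definable_intros definable_is_succ)
    by simp
  from omega_induct[OF assms(1,2) this assms(1) assms(1) assms(1) _ _ assms(3,4)]
  show ?thesis by blast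
qed

section \<open>Products and the first projection\<close>

text \<open>A Kuratowski pair over \<open>x\<close> and \<open>y\<close> is a set of subsets of
  \<open>x\<close> \<union> \<open>y\<close>, so the product is separated from the double power set
  of that union.\<close>

lemma prod_ex:
  assumes xy: "x \<in> M" "y \<in> M"
  shows "\<exists>z\<in>M. is_prod x y z"
proof -
  obtain u where u: "u \<in> M" "is_upair x y u" using pairing xy by blast
  obtain v where v: "v \<in> M" "\<forall>z\<in>M. z \<epsilon> v \<longleftrightarrow> (\<exists>y\<in>M. y \<epsilon> u \<and> z \<epsilon> y)" using union u by blast
  then have v': "z \<epsilon> v \<longleftrightarrow> z \<epsilon> x \<or> z \<epsilon> y" if "z \<in> M" for z
    using u v that xy unfolding is_upair_def by auto
  obtain p where p: "p \<in> M" "\<forall>z\<in>M. z \<epsilon> p \<longleftrightarrow> sub z v" using power v by blast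
  obtain q where q: "q \<in> M" "\<forall>z\<in>M. z \<epsilon> q \<longleftrightarrow> sub z p" using power p by blast
  have "definable (\<lambda>s. \<exists>a\<in>M. \<exists>b\<in>M. a \<epsilon> s 1 \<and> b \<epsilon> s 2 \<and> is_pair a b (s 0))"
    apply (rule definable_Ex[where k = 3])
     apply (rule definable_Ex[where k = 4])
      apply (intro definable_intros definable_is_pair)
    by simp_all
  from separation[OF this q(1) xy xy(1)] obtain z where z: "z \<in> M"
    "\<forall>w\<in>M. w \<epsilon> z \<longleftrightarrow> w \<epsilon> q \<and> (\<exists>a\<in>M. \<exists>b\<in>M. a \<epsilon> x \<and> b \<epsilon> y \<and> is_pair a b w)" by blast
  have "w \<epsilon> q" if "w \<in> M" "a \<in> M" "b \<in> M" "a \<epsilon> x" "b \<epsilon> y" "is_pair a b w" for w a b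
  proof -
    obtain c d where cd: "c \<in> M" "d \<in> M" "is_upair a a c" "is_upair a b d" "is_upair c d w"
      using \<open>is_pair a b w\<close> unfolding is_pair_def by blast
    then have "sub c v" "sub d v" using v' that unfolding is_upair_def sub_def by auto
    then show ?thesis using cd p q that unfolding is_upair_def sub_def by auto
  qed
  then show ?thesis using z unfolding is_prod_def by blast
qed

text \<open>The graph is separated from \<open>S\<close> \<times> \<omega> as the set of pairs whose
  second component is the first coordinate of their first component.\<close>

lemma proj1_ex:
  assumes om: "om \<in> M" "is_omega om" and S: "S \<in> M" "is_prod om om S"
  shows "\<exists>f\<in>M. is_fun f S om \<and> is_proj1 S f"
proof -
  obtain T where T: "T \<in> M" "is_prod S om T" using prod_ex S om by blast
  have "definable (\<lambda>s. \<exists>w\<in>M. \<exists>n\<in>M. \<exists>m\<in>M. is_pair w n (s 0) \<and> is_pair n m w)"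
    apply (rule definable_Ex[where k = 1])
     apply (rule definable_Ex[where k = 2])
      apply (rule definable_Ex[where k = 3])
       apply (intro definable_intros definable_is_pair)
    by simp_all
  from separation[OF this T(1) T(1) T(1) T(1)] obtain f where f: "f \<in> M"
    "\<forall>u\<in>M. u \<epsilon> f \<longleftrightarrow> u \<epsilon> T \<and> (\<exists>w\<in>M. \<exists>n\<in>M. \<exists>m\<in>M. is_pair w n u \<and> is_pair n m w)" by blast
  have rel_f: "rel f w k \<longleftrightarrow> w \<epsilon> S \<and> k \<epsilon> om \<and> (\<exists>m\<in>M. is_pair k m w)" if wk: "w \<in> M" "k \<in> M" for w k
  proof -
    obtain u where u: "u \<in> M" "is_pair w k u" using pair_ex wk by blast
    have "u \<epsilon> T \<longleftrightarrow> w \<epsilon> S \<and> k \<epsilon> om" using T u wk pair_inject unfolding is_prod_def by metis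
    moreover have "(\<exists>w\<in>M. \<exists>n\<in>M. \<exists>m\<in>M. is_pair w n u \<and> is_pair n m w) \<longleftrightarrow> (\<exists>m\<in>M. is_pair k m w)"
      using u wk pair_inject by metis
    ultimately show ?thesis using rel_pair[OF u(2,1)] f u by blast
  qed
  have "\<exists>!b. b \<in> M \<and> rel f a b" if a: "a \<in> M" "a \<epsilon> S" for a
  proof -
    obtain n m where nm: "n \<in> M" "m \<in> M" "n \<epsilon> om" "m \<epsilon> om" "is_pair n m a"
      using S a unfolding is_prod_def by blast
    show ?thesis
    proof (rule ex1I[of _ n])
      show "n \<in> M \<and> rel f a n" using rel_f nm a by blast
      show "b = n" if "b \<in> M \<and> rel f a b" for b
        using that rel_f a nm pair_inject by metis
    qed
  qed
  moreover have "\<forall>w\<in>M. w \<epsilon> f \<longrightarrow> (\<exists>a\<in>M. \<exists>b\<in>M. a \<epsilon> S \<and> b \<epsilon> om \<and> is_pair a b w)"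
    using f T unfolding is_prod_def by blast
  ultimately have fn: "is_fun f S om" unfolding is_fun_def by blast
  have "rel f w n" if "n \<in> M" "m \<in> M" "w \<in> M" "is_pair n m w" "w \<epsilon> S" for n m w
  proof -
    have "n \<epsilon> om" using S that pair_inject unfolding is_prod_def by metis
    then show ?thesis using rel_f that by blast
  qed
  then show ?thesis using fn f om unfolding is_proj1_def by blast
qed

section \<open>Finite sets and finite induction\<close>

lemma finite_set_empty:
  assumes "x \<in> M" "is_empty x"
  shows "finite_set x"
proof -
  obtain om where om: "om \<in> M" "is_omega om" using omega_ex by blast
  then obtain e where e: "e \<in> M" "is_empty e" "e \<epsilon> om" unfolding is_omega_def is_inductive_def by blast
  \<comment> \<open>The empty set \<open>e\<close> serves both as the number 0 and as the empty
    function.\<close>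
  have "is_bij e e x" using e assms unfolding is_bij_def is_fun_def is_empty_def by blast
  then show ?thesis using om e unfolding finite_set_def by blast
qed

text \<open>If \<open>b\<close> is new, a bijection from \<open>n\<close> onto \<open>x\<close> is
  extended by the pair of \<open>n\<close> and \<open>b\<close> to one from the successor of
  \<open>n\<close> onto \<open>y\<close>; otherwise \<open>y = x\<close>.\<close>

lemma finite_set_adjoin:
  assumes x: "x \<in> M" "finite_set x" and b: "b \<in> M" and y: "y \<in> M" "is_adjoin b x y"
  shows "finite_set y"
proof (cases "b \<epsilon> x")
  case True
  then have "y = x" using x y by (intro ext) (auto simp: is_adjoin_def)
  then show ?thesis using x by simp
next
  case False
  obtain om n f where om: "om \<in> M" "is_omega om" and n: "n \<in> M" "n \<epsilon> om"
    and f: "f \<in> M" "is_bij f n x" using x unfolding finite_set_def by blast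
  then have ff: "is_fun f n x" unfolding is_bij_def by blast
  obtain n' where n': "n' \<in> M" "is_succ n n'" "n' \<epsilon> om"
    using om n unfolding is_omega_def is_inductive_def by blast
  obtain w where w: "w \<in> M" "is_pair n b w" using pair_ex n b by blast
  obtain g where g: "g \<in> M" "is_adjoin w f g" using adjoin_ex w f by blast
  have rel_g: "rel g a c \<longleftrightarrow> rel f a c \<or> a = n \<and> c = b" if ac: "a \<in> M" "c \<in> M" for a c
  proof -
    obtain u where u: "u \<in> M" "is_pair a c u" using pair_ex ac by blast
    have "u = w \<longleftrightarrow> a = n \<and> c = b"
      using u w pair_unique pair_inject ac n b by metis
    then show ?thesis using g u rel_pair[OF u(2,1)] unfolding is_adjoin_def by blast
  qed
  \<comment> \<open>This keeps the extended function single-valued at \<open>n\<close>, where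
    \<open>f\<close> has no value.\<close>
  have nn: "\<not> n \<epsilon> n" using mem_irrefl n by blast
  have mem_n': "a \<epsilon> n' \<longleftrightarrow> a \<epsilon> n \<or> a = n" if "a \<in> M" for a
    using n' that unfolding is_succ_def by blast
  have mem_y: "c \<epsilon> y \<longleftrightarrow> c \<epsilon> x \<or> c = b" if "c \<in> M" for c
    using y that unfolding is_adjoin_def by blast
  have dom: "a \<epsilon> n \<and> c \<epsilon> x" if "rel f a c" "a \<in> M" "c \<in> M" for a c
    using rel_fun_mem ff that by blast
  have "\<exists>a\<in>M. \<exists>c\<in>M. a \<epsilon> n' \<and> c \<epsilon> y \<and> is_pair a c u" if u: "u \<in> M" "u \<epsilon> g" for u
  proof (cases "u = w")
    case True
    then show ?thesis using w n b mem_n' mem_y by blast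
  next
    case False
    then have "u \<epsilon> f" using g u unfolding is_adjoin_def by blast
    then show ?thesis using u ff mem_n' mem_y unfolding is_fun_def by meson
  qed
  moreover have "\<exists>!c. c \<in> M \<and> rel g a c" if a: "a \<in> M" "a \<epsilon> n'" for a
  proof (cases "a = n")
    case True
    then show ?thesis using rel_g a b dom nn by blast
  next
    case False
    then have "a \<epsilon> n" using mem_n' a by blast
    then have "\<exists>!c. c \<in> M \<and> rel f a c" using ff a unfolding is_fun_def by blast
    then show ?thesis using rel_g a False by metis
  qed
  moreover have "\<exists>!a. a \<in> M \<and> rel g a c" if c: "c \<in> M" "c \<epsilon> y" for c
  proof (cases "c = b")
    case True
    then show ?thesis using rel_g c n dom \<open>\<not> b \<epsilon> x\<close> by blast
  next
    case False
    then have "c \<epsilon> x" using mem_y c by blast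
    then have "\<exists>!a. a \<in> M \<and> rel f a c" using f c unfolding is_bij_def by blast
    then show ?thesis using rel_g c False by metis
  qed
  ultimately have "is_bij g n' y" unfolding is_bij_def is_fun_def by (intro conjI ballI impI)
  then show ?thesis using om n' g unfolding finite_set_def by blast
qed

text \<open>With a bijection \<open>f\<close> from \<open>n\<close> onto \<open>x\<close>, induction
  on \<open>k\<close> shows that the image of each \<open>k\<close> included in \<open>n\<close>
  belongs to \<open>K\<close>. A set \<open>K\<close> takes the place of a formula so that a family
  formed in a submodel can be used for an induction in the larger model.\<close>

lemma finite_set_induct:
  assumes x: "x \<in> M" "finite_set x" and K: "K \<in> M"
    and empty: "\<exists>e\<in>M. is_empty e \<and> e \<epsilon> K"
    and adjoin: "\<And>y b. y \<in> M \<Longrightarrow> y \<epsilon> K \<Longrightarrow> b \<in> M \<Longrightarrow> b \<epsilon> x \<Longrightarrow> \<exists>z\<in>M. is_adjoin b y z \<and> z \<epsilon> K"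
  shows "x \<epsilon> K"
proof -
  obtain om n f where om: "om \<in> M" "is_omega om" and n: "n \<in> M" "n \<epsilon> om"
    and f: "f \<in> M" "is_bij f n x" using x unfolding finite_set_def by blast
  then have ff: "is_fun f n x" unfolding is_bij_def by blast
  let ?image = "\<lambda>f k y. \<forall>b\<in>M. b \<epsilon> y \<longleftrightarrow> (\<exists>a\<in>M. a \<epsilon> k \<and> rel f a b)"
  \<comment> \<open>Variables 0 to 3 stand for \<open>k\<close>, \<open>n\<close>, \<open>K\<close>
    and \<open>f\<close>. Induction runs through all of \<omega> while \<open>f\<close> is defined
    on \<open>n\<close> only, so the claim is restricted to \<open>k\<close> included in
    \<open>n\<close>.\<close>
  have "definable (\<lambda>s. sub (s 0) (s 1) \<longrightarrow> (\<exists>y\<in>M. y \<epsilon> s 2 \<and> ?image (s 3) (s 0) y))"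
    apply (rule definable_Imp, rule definable_sub)
    apply (rule definable_Ex[where k = 4])
     apply (rule definable_Conj, rule definable_Mem)
     apply (rule definable_All[where k = 5])
      apply (rule definable_Iff, rule definable_Mem)
      apply (rule definable_Ex[where k = 6])
       apply (intro definable_intros definable_rel)
    by simp_all
  moreover have "\<exists>y\<in>M. y \<epsilon> K \<and> ?image f k y" if "is_empty k" for k
    using empty that unfolding is_empty_def by blast
  moreover have "\<exists>y\<in>M. y \<epsilon> K \<and> ?image f k' y"
    if k: "k \<in> M" "sub k n \<longrightarrow> (\<exists>y\<in>M. y \<epsilon> K \<and> ?image f k y)" "k' \<in> M" "is_succ k k'" "sub k' n" for k k'
  proof -
    have mem_k': "a \<epsilon> k' \<longleftrightarrow> a \<epsilon> k \<or> a = k" if "a \<in> M" for a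
      using k that unfolding is_succ_def by blast
    then have kn: "k \<epsilon> n" "sub k n" using k unfolding sub_def by blast+
    then obtain y where y: "y \<in> M" "y \<epsilon> K" "?image f k y" using k by blast
    obtain b where b: "b \<in> M" "rel f k b" using ff kn k unfolding is_fun_def by blast
    then obtain z where z: "z \<in> M" "is_adjoin b y z" "z \<epsilon> K"
      using adjoin y rel_fun_mem ff k by meson
    have "rel f k c \<longleftrightarrow> c = b" if "c \<in> M" for c using rel_fun_unique ff b k that by blast
    \<comment> \<open>The image of the successor of \<open>k\<close> is the image of
      \<open>k\<close> together with the value \<open>b\<close> of \<open>f\<close> at
      \<open>k\<close>.\<close>
    then have "?image f k' z" using z y mem_k' k unfolding is_adjoin_def by metis
    then show ?thesis using z by blast
  qed
  ultimately have "sub n n \<longrightarrow> (\<exists>y\<in>M. y \<epsilon> K \<and> ?image f n y)"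
    using omega_induct[OF om, of "\<lambda>k n K f. sub k n \<longrightarrow> (\<exists>y\<in>M. y \<epsilon> K \<and> ?image f k y)" n K f n] n K f(1)
    by blast
  then obtain y where y: "y \<in> M" "y \<epsilon> K" "?image f n y" unfolding sub_def by blast
  \<comment> \<open>Since \<open>f\<close> maps onto \<open>x\<close>, the image of all of
    \<open>n\<close> is \<open>x\<close>.\<close>
  have "b \<epsilon> y \<longleftrightarrow> b \<epsilon> x" if "b \<in> M" for b
    using y that f rel_fun_mem[OF ff] unfolding is_bij_def by blast
  then have "y = x" using y x ext by blast
  then show ?thesis using y by simp
qed

end

section \<open>Absoluteness between a model and a transitive submodel\<close>

locale transitive_submodel =
  V: zfc_model V E + W: zfc_model W E for V W :: "'a set" and E :: "'a \<Rightarrow> 'a \<Rightarrow> bool"  (infix "\<epsilon>" 50) +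
  assumes subset: "V \<subseteq> W" and trans: "x \<in> V \<Longrightarrow> y \<in> W \<Longrightarrow> y \<epsilon> x \<Longrightarrow> y \<in> V"
begin

lemma in_W: "x \<in> V \<Longrightarrow> x \<in> W"
  using subset by blast

text \<open>By transitivity a set of \<open>V\<close> has the same members in both models. The same
  reason covers \<open>is_upair\<close>, \<open>is_adjoin\<close> and
  \<open>is_succ\<close>.\<close>

lemma is_empty_absolute: "x \<in> V \<Longrightarrow> W.is_empty x \<longleftrightarrow> V.is_empty x"
  using subset trans unfolding W.is_empty_def V.is_empty_def by blast

lemma is_upair_absolute:
  "a \<in> V \<Longrightarrow> b \<in> V \<Longrightarrow> u \<in> V \<Longrightarrow> W.is_upair a b u \<longleftrightarrow> V.is_upair a b u"
  using subset trans unfolding W.is_upair_def V.is_upair_def by blast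

lemma is_adjoin_absolute:
  "a \<in> V \<Longrightarrow> b \<in> V \<Longrightarrow> u \<in> V \<Longrightarrow> W.is_adjoin a b u \<longleftrightarrow> V.is_adjoin a b u"
  using subset trans unfolding W.is_adjoin_def V.is_adjoin_def by blast

lemma is_succ_absolute: "a \<in> V \<Longrightarrow> b \<in> V \<Longrightarrow> W.is_succ a b \<longleftrightarrow> V.is_succ a b"
  using subset trans unfolding W.is_succ_def V.is_succ_def by blast

lemma is_pair_absolute:
  assumes "a \<in> V" "b \<in> V" "w \<in> V"
  shows "W.is_pair a b w \<longleftrightarrow> V.is_pair a b w"
proof
  assume "W.is_pair a b w"
  then obtain u v where uv: "u \<in> W" "v \<in> W" "W.is_upair a a u" "W.is_upair a b v" "W.is_upair u v w"
    unfolding W.is_pair_def by blast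
  \<comment> \<open>The two witnesses are members of \<open>w\<close>, so transitivity puts them
    into \<open>V\<close>.\<close>
  then have "u \<in> V" "v \<in> V" using trans[OF assms(3)] unfolding W.is_upair_def by blast+
  then show "V.is_pair a b w" using uv is_upair_absolute assms unfolding V.is_pair_def by blast
next
  assume "V.is_pair a b w"
  then show "W.is_pair a b w"
    using is_upair_absolute assms in_W unfolding V.is_pair_def W.is_pair_def by blast
qed

text \<open>
  Neither \<open>V\<close> nor \<open>W\<close> need be well-founded, but if some element of the \<open>\<omega>\<close> of \<open>V\<close> is missing
  from that of \<open>W\<close>, then \<open>W\<close> can separate these and Foundation in \<open>W\<close> yields a least one.
\<close>

lemma omega_subset:
  assumes om: "om \<in> V" "V.is_omega om" and om': "om' \<in> W" "W.is_omega om'"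
    and n: "n \<in> V" "n \<epsilon> om"
  shows "n \<epsilon> om'"
proof (rule ccontr)
  assume notin: "\<not> n \<epsilon> om'"
  have "W.definable (\<lambda>s. \<not> s 0 \<epsilon> s 1)" by (intro W.definable_intros)
  from W.separation[OF this in_W[OF om(1)] om'(1) om'(1) om'(1)] obtain d where d: "d \<in> W"
    "\<forall>z\<in>W. z \<epsilon> d \<longleftrightarrow> z \<epsilon> om \<and> \<not> z \<epsilon> om'" by blast
  have "n \<in> W" "n \<epsilon> d" using n d in_W notin by blast+
  then obtain k where k: "k \<in> W" "k \<epsilon> d" "\<And>z. z \<in> W \<Longrightarrow> z \<epsilon> d \<Longrightarrow> \<not> z \<epsilon> k"
    using W.foundation d by metis
  then have k': "k \<in> V" "k \<epsilon> om" "\<not> k \<epsilon> om'" using d trans om by blast+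
  have ind: "W.is_inductive om'" using om' unfolding W.is_omega_def by blast
  from V.omega_cases[OF om k'(1,2)] show False
  proof (elim disjE bexE conjE)
    assume "V.is_empty k"
    then have "W.is_empty k" using is_empty_absolute k' by blast
    moreover obtain e where e: "e \<in> W" "W.is_empty e" "e \<epsilon> om'"
      using ind unfolding W.is_inductive_def by blast
    ultimately have "k = e" using k by (intro W.ext) (auto simp: W.is_empty_def)
    then show False using e k' by blast
  next
    fix m assume m: "m \<in> V" "m \<epsilon> om" "V.is_succ m k"
    then have s: "W.is_succ m k" "m \<in> W" using is_succ_absolute k' in_W by blast+
    then have "m \<epsilon> k" unfolding W.is_succ_def by blast
    \<comment> \<open>By minimality of \<open>k\<close> its member \<open>m\<close> is outside
      \<open>d\<close>; as \<open>m\<close> lies in \<open>om\<close>, it must lie in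
      \<open>om'\<close>.\<close>
    then have "m \<epsilon> om'" using k d m s by blast
    then obtain z where z: "z \<in> W" "W.is_succ m z" "z \<epsilon> om'"
      using ind s unfolding W.is_inductive_def by blast
    then have "k = z" using s k by (intro W.ext) (auto simp: W.is_succ_def)
    then show False using z k' by blast
  qed
qed

text \<open>Places a condition of \<open>V\<close> inside the domain of the projection of
  \<open>W\<close>: coordinates pass from one \<omega> to the other by \<open>omega_subset\<close>,
  and pairing is absolute.\<close>

lemma omega_sq_subset:
  assumes "A \<in> V" "S' \<in> V" "V.is_omega_sq S'" "V.sub A S'"
    and "S \<in> W" "W.is_omega_sq S"
  shows "W.sub A S"
  unfolding W.sub_def
proof (intro ballI impI)
  fix w assume w: "w \<in> W" "w \<epsilon> A"
  obtain om where om: "om \<in> V" "V.is_omega om" "V.is_prod om om S'"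
    using assms unfolding V.is_omega_sq_def by blast
  obtain om' where om': "om' \<in> W" "W.is_omega om'" "W.is_prod om' om' S"
    using assms unfolding W.is_omega_sq_def by blast
  have wV: "w \<in> V" "w \<epsilon> S'" using trans w assms unfolding V.sub_def by blast+
  then obtain a b where ab: "a \<in> V" "b \<in> V" "a \<epsilon> om" "b \<epsilon> om" "V.is_pair a b w"
    using om unfolding V.is_prod_def by blast
  then have "a \<epsilon> om'" "b \<epsilon> om'" using omega_subset om om' by blast+
  then show "w \<epsilon> S" using om' ab in_W w is_pair_absolute wV unfolding W.is_prod_def by blast
qed

text \<open>
  Finiteness of \<open>B\<close> in \<open>W\<close> reflects to \<open>V\<close>: the family \<open>K\<close> of the good subsets of \<open>B\<close>, formed in \<open>V\<close>,
  is a set of \<open>W\<close>, and finite induction in \<open>W\<close> shows that it contains \<open>B\<close>.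
\<close>

lemma finite_section:
  assumes B: "B \<in> V" "W.finite_set B" and n: "n \<in> V"
    and fibre: "\<And>w. w \<in> V \<Longrightarrow> w \<epsilon> B \<Longrightarrow> \<exists>m\<in>V. V.is_pair n m w"
  shows "\<exists>x\<in>V. V.is_section B n x \<and> V.finite_set x"
proof -
  obtain p where p: "p \<in> V" "\<forall>z\<in>V. z \<epsilon> p \<longleftrightarrow> V.sub z B" using V.power B by blast
  \<comment> \<open>A subset of \<open>B\<close> is good if its section at \<open>n\<close> is
    finite in the sense of \<open>V\<close>. The property is evaluated in \<open>V\<close>, so the
    resulting \<open>K\<close> is an element of \<open>V\<close> and thus of
    \<open>W\<close>.\<close>
  have "V.definable (\<lambda>s. \<exists>x\<in>V. V.is_section (s 0) (s 1) x \<and> V.finite_set x)"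
    apply (rule V.definable_Ex[where k = 2])
     apply (intro V.definable_intros V.definable_is_section V.definable_finite_set)
    by simp
  from V.separation[OF this p(1) n n n] obtain K where KV: "K \<in> V"
    "\<forall>z\<in>V. z \<epsilon> K \<longleftrightarrow> z \<epsilon> p \<and> (\<exists>x\<in>V. V.is_section z n x \<and> V.finite_set x)" by blast
  then have K: "z \<epsilon> K \<longleftrightarrow> V.sub z B \<and> (\<exists>x\<in>V. V.is_section z n x \<and> V.finite_set x)"
    if "z \<in> V" for z
    using p that by blast
  have "B \<epsilon> K"
  proof (rule W.finite_set_induct)
    show "B \<in> W" "W.finite_set B" "K \<in> W" using B in_W KV by blast+
  next
    obtain e where e: "e \<in> V" "V.is_empty e"
      using V.infinity unfolding V.is_inductive_def by blast
    then have "V.is_section e n e" "V.sub e B"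
      unfolding V.is_section_def V.rel_def V.is_empty_def V.sub_def by blast+
    then have "e \<epsilon> K" using K e V.finite_set_empty by blast
    then show "\<exists>e\<in>W. W.is_empty e \<and> e \<epsilon> K" using e is_empty_absolute in_W by blast
  next
    fix y b assume yb: "y \<in> W" "y \<epsilon> K" "b \<in> W" "b \<epsilon> B"
    then have V: "y \<in> V" "b \<in> V" using trans KV B yb by blast+
    obtain m where m: "m \<in> V" "V.is_pair n m b" using fibre V yb by blast
    obtain x where x: "x \<in> V" "V.is_section y n x" "V.finite_set x" using K V yb by blast
    obtain x' where x': "x' \<in> V" "V.is_adjoin m x x'" using V.adjoin_ex x m by blast
    obtain z where z: "z \<in> V" "V.is_adjoin b y z" using V.adjoin_ex V by blast
    \<comment> \<open>Since \<open>b\<close> is the pair of \<open>n\<close> and \<open>m\<close>,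
      adjoining \<open>b\<close> to \<open>y\<close> adjoins exactly \<open>m\<close> to the section
      at \<open>n\<close>.\<close>
    have "V.rel z n k \<longleftrightarrow> V.rel y n k \<or> k = m" if "k \<in> V" for k
    proof -
      obtain u where u: "u \<in> V" "V.is_pair n k u" using V.pair_ex n \<open>k \<in> V\<close> by blast
      have "u = b \<longleftrightarrow> k = m"
        using u m V.pair_unique V.pair_inject that n V by metis
      then show ?thesis using z u V.rel_pair[OF u(2,1)] unfolding V.is_adjoin_def by blast
    qed
    then have "V.is_section z n x'" using x x' unfolding V.is_section_def V.is_adjoin_def by blast
    moreover have "V.finite_set x'" using V.finite_set_adjoin x x' m by blast
    moreover have "V.sub y B" using K V yb by blast
    then have "V.sub z B" using yb z unfolding V.sub_def V.is_adjoin_def by auto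
    ultimately have "z \<epsilon> K" using K z x' by blast
    then show "\<exists>z\<in>W. W.is_adjoin b y z \<and> z \<epsilon> K" using z V is_adjoin_absolute in_W by blast
  qed
  then show ?thesis using K B by blast
qed

section \<open>The first projection on a condition\<close>

text \<open>A constant value would be the only index with an infinite section, making
  \<open>I\<close> a singleton. A finite fibre over some \<open>n\<close> in \<open>I\<close> would,
  by \<open>finite_section\<close>, make the section of \<open>A\<close> at \<open>n\<close> finite
  in \<open>V\<close>.\<close>

lemma proj1_not_finite_to_one_or_constant:
  assumes A: "A \<in> V" "V.is_condition A"
    and S: "S \<in> W" "W.is_omega_sq S" and f: "f \<in> W" "W.is_proj1 S f"
  shows "\<not> W.finite_to_one_on f A" "\<not> W.constant_on f A"
proof -
  obtain S' where "S' \<in> V" "V.is_omega_sq S'" "V.sub A S'"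
    using A unfolding V.is_condition_def by blast
  then have AS: "W.sub A S" using omega_sq_subset A S by blast
  obtain I where I: "I \<in> V" "\<not> V.finite_set I"
    "\<And>n. n \<in> V \<Longrightarrow> n \<epsilon> I \<Longrightarrow> \<exists>x\<in>V. V.is_section A n x \<and> \<not> V.finite_set x"
    using A unfolding V.is_condition_def by blast
  obtain om where ff: "W.is_fun f S om" using f unfolding W.is_proj1_def by blast
  have rel_f: "W.rel f w k \<longleftrightarrow> k = n"
    if w: "w \<in> V" "w \<epsilon> A" "V.is_pair n m w" "n \<in> V" "m \<in> V" "k \<in> W" for w n m k
  proof -
    have "W.rel f w n"
      using f w in_W is_pair_absolute AS unfolding W.is_proj1_def W.sub_def by blast
    then show ?thesis using W.rel_fun_unique ff w in_W by metis
  qed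
  obtain n where n: "n \<in> V" "n \<epsilon> I" using V.finite_set_empty I unfolding V.is_empty_def by blast
  obtain x where x: "x \<in> V" "V.is_section A n x" "\<not> V.finite_set x" using I n by blast
  show "\<not> W.constant_on f A"
  proof
    assume "W.constant_on f A"
    then obtain k where k: "k \<in> W" "\<And>w. w \<in> W \<Longrightarrow> w \<epsilon> A \<Longrightarrow> W.rel f w k"
      unfolding W.constant_on_def by blast
    have eq: "i = k" if i: "i \<in> V" "i \<epsilon> I" for i
    proof -
      obtain y where y: "y \<in> V" "V.is_section A i y" "\<not> V.finite_set y" using I i by blast
      then obtain m where m: "m \<in> V" "m \<epsilon> y"
        using V.finite_set_empty unfolding V.is_empty_def by blast
      then obtain w where "w \<in> V" "V.is_pair i m w" "w \<epsilon> A"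
        using y unfolding V.is_section_def V.rel_def by blast
      then show ?thesis using rel_f[of w i m k] k i m in_W by blast
    qed
    obtain e where e: "e \<in> V" "V.is_empty e"
      using V.infinity unfolding V.is_inductive_def by blast
    \<comment> \<open>Every member of \<open>I\<close> equals \<open>k\<close>, as does
      \<open>n\<close>; with \<open>e\<close> empty this says that \<open>I\<close> is
      {\<open>n\<close>}.\<close>
    have "V.is_adjoin n e I" using eq e n unfolding V.is_adjoin_def V.is_empty_def by metis
    then show False using V.finite_set_adjoin V.finite_set_empty e n I by blast
  qed
  show "\<not> W.finite_to_one_on f A"
  proof
    assume fin: "W.finite_to_one_on f A"
    have "V.definable (\<lambda>s. \<exists>m\<in>V. V.is_pair (s 1) m (s 0))"
      by (rule V.definable_Ex[where k = 2]) (rule V.definable_is_pair, simp)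
    \<comment> \<open>The fibre over \<open>n\<close> is formed in \<open>V\<close>, as
      \<open>finite_section\<close> requires; the next claim identifies it with the fibre of
      \<open>f\<close> in \<open>W\<close>.\<close>
    from V.separation[OF this A(1) n(1) n(1) n(1)] obtain B where B: "B \<in> V"
      "\<forall>w\<in>V. w \<epsilon> B \<longleftrightarrow> w \<epsilon> A \<and> (\<exists>m\<in>V. V.is_pair n m w)" by blast
    have "w \<epsilon> B \<longleftrightarrow> w \<epsilon> A \<and> W.rel f w n" if "w \<in> W" for w
    proof
      assume "w \<epsilon> B"
      then show "w \<epsilon> A \<and> W.rel f w n"
        using B that trans rel_f n in_W by metis
    next
      assume w: "w \<epsilon> A \<and> W.rel f w n"
      then have "w \<in> V" using trans A that by blast
      \<comment> \<open>As a member of \<open>A\<close>, \<open>w\<close> is a pair in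
        \<open>V\<close>; its value under \<open>f\<close> is its first coordinate \<open>i\<close>,
        so \<open>i = n\<close>.\<close>
      moreover obtain i m where "i \<in> V" "m \<in> V" "V.is_pair i m w"
        using \<open>w \<in> V\<close> w \<open>S' \<in> V\<close> \<open>V.is_omega_sq S'\<close> \<open>V.sub A S'\<close>
        unfolding V.is_omega_sq_def V.is_prod_def V.sub_def by blast
      ultimately show "w \<epsilon> B" using rel_f[of w i m n] w n in_W B by blast
    qed
    then have "W.finite_set B"
      using fin[unfolded W.finite_to_one_on_def, rule_format, OF in_W[OF n(1)] in_W[OF B(1)]] by blast
    then obtain y where y: "y \<in> V" "V.is_section B n y" "V.finite_set y"
      using finite_section B n by blast
    \<comment> \<open>Passing from \<open>A\<close> to its fibre \<open>B\<close> leaves the section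
      at \<open>n\<close> unchanged, so the infinite \<open>x\<close> and the finite
      \<open>y\<close> coincide.\<close>
    have "V.rel A n m \<longleftrightarrow> V.rel B n m" if "m \<in> V" for m
      using B that unfolding V.rel_def by blast
    then have "x = y" using x y by (intro V.ext) (auto simp: V.is_section_def)
    then show False using x y by simp
  qed
qed

end

theorem corollary29:
  fixes V W :: "'a set" and E :: "'a \<Rightarrow> 'a \<Rightarrow> bool" and P G :: 'a
  assumes "set_model.ZFC V E"
    and "P \<in> V" and "set_model.is_forcing V E P"
    and "generic_extension V E G W"
    and "set_model.generic_filter V E P {p \<in> W. E p G}"
  shows "\<exists>S\<in>W. \<exists>pi1\<in>W.
           set_model.is_omega_sq W E S \<and> set_model.is_proj1 W E S pi1 \<and>
           (\<forall>A\<in>W. E A G \<longrightarrow>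
              \<not> (set_model.finite_to_one_on W E pi1 A \<or> set_model.constant_on W E pi1 A)) \<and>
           \<not> set_model.P_point W E S G"
proof -
  interpret transitive_submodel V W E
    using assms(1,4) unfolding generic_extension_def by unfold_locales blast+
  obtain om where om: "om \<in> W" "W.is_omega om" using W.omega_ex by blast
  obtain S where S: "S \<in> W" "W.is_prod om om S" using W.prod_ex om by blast
  obtain f where f: "f \<in> W" "W.is_fun f S om" "W.is_proj1 S f" using W.proj1_ex om S by blast
  have sq: "W.is_omega_sq S" using om S unfolding W.is_omega_sq_def by blast
  \<comment> \<open>The members of \<open>G\<close> form a filter on \<open>P\<close>, whose
    elements are the conditions of \<open>V\<close>.\<close>
  have "A \<in> V \<and> V.is_condition A" if "A \<in> W" "E A G" for A
    using assms(3,5) that unfolding V.generic_filter_def V.is_forcing_def by blast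
  then have *: "\<not> (W.finite_to_one_on f A \<or> W.constant_on f A)" if "A \<in> W" "E A G" for A
    using proj1_not_finite_to_one_or_constant S(1) sq f(1,3) that by blast
  \<comment> \<open>The projection \<open>f\<close> itself is the function into \<omega> that
    violates the P-point property.\<close>
  then have "\<not> W.P_point S G" using om f unfolding W.P_point_def by blast
  then show ?thesis using * S(1) sq f(1,3) by blast
qed

end
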